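(* Let $G$ be a group equipped with a bi-invariant metric $d$, with associated norm $\|g\|=d(g,1)$, let $\omega$ be a non-principal ultrafilter on $\mathbb{N}$, and let $\operatorname{Cone}_\omega(G)$ be the asymptotic cone of $(G,d)$ with respect to $\omega$. Let $f\colon G\to\mathbb{R}$ be a function for which there exists $C>0$ such that $|f(g)|\le C\|g\|$ for all $g\in G$. Let $F_\omega\colon\operatorname{Cone}_\omega(G)\to\mathbb{R}$ be defined by $$F_\omega[g_n]=\lim_\omega\frac{f(g_n)}{n}.$$ 1. If $f$ is a partial quasimorphism, then $F_\omega$ is a partial quasimorphism; if $f$ is a homogeneous partial quasimorphism, then $F_\omega$ is a homogeneous partial quasimorphism. 2. If $|f(g)-f(gh)+f(h)|\le\varphi(\|g\|+\|h\|)$ for all $g,h\in G$, where $\varphi$ is a real-valued function of a non-negative real variable with $\frac{\varphi(n)}{n}\to 0$, then $F_\omega$ is a homomorphism. 3. $F_\omega\circ\eta=f_\omega$, where $\eta\colon G\to\operatorname{Cone}_\omega(G)$ is defined by $\eta(g)=[g^n]$ and $f_\omega\colon G\to\mathbb{R}$ is defined by $f_\omega(g)=\lim_\omega\frac{f(g^n)}{n}$.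
   Context: An ultrafilter $\omega$ on $\mathbb{N}$ is viewed as a finitely additive measure $\omega\colon 2^{\mathbb{N}}\to\{0,1\}$; it is non-principal if every finite set has measure zero. For a bounded real sequence, $\lim_\omega a_n=a$ means that $\omega\{n : |a_n-a|<\varepsilon\}=1$ for every $\varepsilon>0$. Asymptotic cone: let $\prod_0 G=\{(g_n)\in G^{\mathbb{N}} : \|g_n\|=O(n)\}$, a group under pointwise multiplication, with the degenerate norm $\|(g_n)\|_\omega=\lim_\omega\frac{\|g_n\|}{n}$ (degenerate means that some elements can have norm zero). The elements with $\|(g_n)\|_\omega=0$ form a normal subgroup, and $\operatorname{Cone}_\omega(G)$ is the corresponding quotient group, with the induced norm $\|\cdot\|_\omega$ and the associated metric $d_\omega$; $[g_n]$ denotes the class of $(g_n)$. For a group $H$ with a norm $\|\cdot\|$, a function $f\colon H\to\mathbb{R}$ is a partial quasimorphism relative to $\|\cdot\|$ if there is $D\ge0$ with $|f(g)-f(gh)+f(h)|\le D\min\{\|g\|,\|h\|\}$ for all $g,h\in H$; it is homogeneous if $f(g^n)=nf(g)$ for all $g\in H$, $n\in\mathbb{N}$. Partial quasimorphisms on $G$ are taken relative to $\|\cdot\|$, and those on $\operatorname{Cone}_\omega(G)$ relative to $\|\cdot\|_\omega$.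
   Formalization: The bound |f(g)| ≤ C‖g‖ alone need not make F_ω well defined on classes, so item 3 is stated for those f for which it is; in items 1 and 2 well-definedness is proved. In item 2, φ(n)/n → 0 is read with n a real variable. *)

theory Defs
  imports
    "HOL-Analysis.Abstract_Metric_Spaces"
    "HOL-Library.Landau_Symbols"
    "HOL-Algebra.Elementary_Groups"
begin

text \<open>
  An ultrafilter is given as a \<open>filter\<close>; a set \<open>A\<close> has measure one when
  \<open>eventually (\<lambda>n. n \<in> A) \<omega>\<close>. The limit along \<open>\<omega>\<close> is the library's
  \<open>Lim \<omega>\<close>: indeed \<open>(a \<longlongrightarrow> l) \<omega>\<close> says that every set
  \<open>{n. dist (a n) l < e}\<close> with \<open>e > 0\<close> has measure one.
\<close>

definition nonprincipal_ultrafilter :: "nat filter \<Rightarrow> bool" where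
  "nonprincipal_ultrafilter \<omega> \<longleftrightarrow>
     \<omega> \<noteq> bot \<and>
     (\<forall>A. eventually (\<lambda>n. n \<in> A) \<omega> \<or> eventually (\<lambda>n. n \<notin> A) \<omega>) \<and>
     (\<forall>A. finite A \<longrightarrow> eventually (\<lambda>n. n \<notin> A) \<omega>)"

locale bi_invariant_metric_group =
  group G + Metric_space "carrier G" d
  for G :: "('a, 'b) monoid_scheme" (structure) and d :: "'a \<Rightarrow> 'a \<Rightarrow> real" +
  assumes left_invariant:
    "\<lbrakk>x \<in> carrier G; g \<in> carrier G; h \<in> carrier G\<rbrakk> \<Longrightarrow> d (x \<otimes> g) (x \<otimes> h) = d g h"
  and right_invariant:
    "\<lbrakk>x \<in> carrier G; g \<in> carrier G; h \<in> carrier G\<rbrakk> \<Longrightarrow> d (g \<otimes> x) (h \<otimes> x) = d g h"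

definition metric_norm :: "('a, 'b) monoid_scheme \<Rightarrow> ('a \<Rightarrow> 'a \<Rightarrow> real) \<Rightarrow> 'a \<Rightarrow> real" where
  "metric_norm G d g = d g \<one>\<^bsub>G\<^esub>"

text \<open>The norm on \<open>H\<close> is an arbitrary function here; it is a norm in both intended uses.\<close>

definition partial_quasimorphism ::
    "('a, 'b) monoid_scheme \<Rightarrow> ('a \<Rightarrow> real) \<Rightarrow> ('a \<Rightarrow> real) \<Rightarrow> bool" where
  "partial_quasimorphism H N f \<longleftrightarrow>
     (\<exists>D\<ge>0. \<forall>g\<in>carrier H. \<forall>h\<in>carrier H.
        \<bar>f g - f (g \<otimes>\<^bsub>H\<^esub> h) + f h\<bar> \<le> D * min (N g) (N h))"

definition homogeneous :: "('a, 'b) monoid_scheme \<Rightarrow> ('a \<Rightarrow> real) \<Rightarrow> bool" where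
  "homogeneous H f \<longleftrightarrow> (\<forall>g\<in>carrier H. \<forall>n::nat. f (g [^]\<^bsub>H\<^esub> n) = real n * f g)"

definition real_group :: "real monoid" where
  "real_group = \<lparr>carrier = UNIV, monoid.mult = (+), one = 0\<rparr>"

definition prod0 ::
    "('a, 'b) monoid_scheme \<Rightarrow> ('a \<Rightarrow> 'a \<Rightarrow> real) \<Rightarrow> (nat \<Rightarrow> 'a) monoid" where
  "prod0 G d =
     \<lparr>carrier = {g. (\<forall>n. g n \<in> carrier G) \<and> (\<lambda>n. metric_norm G d (g n)) \<in> O(\<lambda>n. real n)},
      monoid.mult = (\<lambda>g h n. g n \<otimes>\<^bsub>G\<^esub> h n),
      one = (\<lambda>n. \<one>\<^bsub>G\<^esub>)\<rparr>"

text \<open>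
  The term with index \<open>0\<close> is irrelevant: the limit is along a non-principal ultrafilter.
\<close>

definition lim_rate :: "nat filter \<Rightarrow> ('a \<Rightarrow> real) \<Rightarrow> (nat \<Rightarrow> 'a) \<Rightarrow> real" where
  "lim_rate \<omega> f g = Lim \<omega> (\<lambda>n. f (g n) / real n)"

definition prod0_norm ::
    "('a, 'b) monoid_scheme \<Rightarrow> ('a \<Rightarrow> 'a \<Rightarrow> real) \<Rightarrow> nat filter \<Rightarrow> (nat \<Rightarrow> 'a) \<Rightarrow> real" where
  "prod0_norm G d \<omega> = lim_rate \<omega> (metric_norm G d)"

definition null_subgroup ::
    "('a, 'b) monoid_scheme \<Rightarrow> ('a \<Rightarrow> 'a \<Rightarrow> real) \<Rightarrow> nat filter \<Rightarrow> (nat \<Rightarrow> 'a) set" where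
  "null_subgroup G d \<omega> = {g \<in> carrier (prod0 G d). prod0_norm G d \<omega> g = 0}"

definition Cone ::
    "('a, 'b) monoid_scheme \<Rightarrow> ('a \<Rightarrow> 'a \<Rightarrow> real) \<Rightarrow> nat filter \<Rightarrow> (nat \<Rightarrow> 'a) set monoid" where
  "Cone G d \<omega> = prod0 G d Mod null_subgroup G d \<omega>"

definition cone_class ::
    "('a, 'b) monoid_scheme \<Rightarrow> ('a \<Rightarrow> 'a \<Rightarrow> real) \<Rightarrow> nat filter \<Rightarrow> (nat \<Rightarrow> 'a) \<Rightarrow> (nat \<Rightarrow> 'a) set" where
  "cone_class G d \<omega> g = null_subgroup G d \<omega> #>\<^bsub>prod0 G d\<^esub> g"

text \<open>
  Functions on the cone are induced from functions on representatives. With \<open>the_elem\<close>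
  the value is meaningful only if all representatives of the class agree.
\<close>

definition cone_norm ::
    "('a, 'b) monoid_scheme \<Rightarrow> ('a \<Rightarrow> 'a \<Rightarrow> real) \<Rightarrow> nat filter \<Rightarrow> (nat \<Rightarrow> 'a) set \<Rightarrow> real" where
  "cone_norm G d \<omega> c = the_elem (prod0_norm G d \<omega> ` c)"

definition cone_ext :: "nat filter \<Rightarrow> ('a \<Rightarrow> real) \<Rightarrow> (nat \<Rightarrow> 'a) set \<Rightarrow> real" where
  "cone_ext \<omega> f c = the_elem (lim_rate \<omega> f ` c)"

text \<open>
  A linear bound on \<open>f\<close> makes the limits exist but does not make them independent of the
  representative. For example, on the integers let \<open>f\<close> be \<open>\<bar>x\<bar>\<close> at even \<open>x\<close> and \<open>0\<close> at
  odd \<open>x\<close>: the sequences \<open>2n\<close> and \<open>2n + 1\<close> are in the same class.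
\<close>

definition cone_ext_well_defined ::
    "('a, 'b) monoid_scheme \<Rightarrow> ('a \<Rightarrow> 'a \<Rightarrow> real) \<Rightarrow> nat filter \<Rightarrow> ('a \<Rightarrow> real) \<Rightarrow> bool" where
  "cone_ext_well_defined G d \<omega> f \<longleftrightarrow>
     (\<forall>g\<in>carrier (prod0 G d). \<forall>h\<in>carrier (prod0 G d).
        cone_class G d \<omega> g = cone_class G d \<omega> h \<longrightarrow> lim_rate \<omega> f g = lim_rate \<omega> f h)"

definition cone_power ::
    "('a, 'b) monoid_scheme \<Rightarrow> ('a \<Rightarrow> 'a \<Rightarrow> real) \<Rightarrow> nat filter \<Rightarrow> 'a \<Rightarrow> (nat \<Rightarrow> 'a) set" where
  "cone_power G d \<omega> g = cone_class G d \<omega> (\<lambda>n. g [^]\<^bsub>G\<^esub> n)"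

definition power_limit ::
    "('a, 'b) monoid_scheme \<Rightarrow> nat filter \<Rightarrow> ('a \<Rightarrow> real) \<Rightarrow> 'a \<Rightarrow> real" where
  "power_limit G \<omega> f g = Lim \<omega> (\<lambda>n. f (g [^]\<^bsub>G\<^esub> n) / real n)"

end

theory Submission
  imports Defs
begin

text \<open>
  Write \<open>rate f g\<close> for the limit of \<open>f (g n) / n\<close> along \<open>\<omega>\<close>. A linear bound on \<open>f\<close> makes these
  quotients bounded along every sequence \<open>g\<close> of linear growth, so the limit exists, and it
  vanishes on the null sequences. Limits preserve sums and weak inequalities; therefore any bound
  on the defect \<open>f x - f (x y) + f y\<close> passes, after division by \<open>n\<close>, to a bound on the defect of
  \<open>rate f\<close> on the group of sequences of linear growth. A bound by \<open>D * min (N x) (N y)\<close> keeps its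
  form (\<open>partial_quasimorphism_rate\<close>), while a sublinear bound becomes zero
  (\<open>rate_mult_if_sublinear_defect\<close>).

  In both cases the defect of \<open>rate f\<close> is zero when one of the two sequences is null. Sequences
  in the same class differ by a null factor, so \<open>rate f\<close> is constant on classes and everything
  known about it descends to the cone (\<open>cone_ext_well_definedI\<close>, \<open>cone_ext_class\<close>). The norm of
  the group is itself a linearly bounded partial quasimorphism, so that the norm of the cone is
  well defined for the same reason.
\<close>

section \<open>Limits along an ultrafilter\<close>

text \<open>
  A compact interval contains a cluster point of the sequence, and a cluster point along an
  ultrafilter is a limit.
\<close>

lemma ultrafilter_bounded_tendsto:
  fixes a :: "nat \<Rightarrow> real"
  assumes "nonprincipal_ultrafilter \<omega>" and bounded: "eventually (\<lambda>n. \<bar>a n\<bar> \<le> B) \<omega>"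
  shows "\<exists>l. (a \<longlongrightarrow> l) \<omega>"
proof -
  have nontrivial: "\<omega> \<noteq> bot"
    and dichotomy: "\<And>A. eventually (\<lambda>n. n \<in> A) \<omega> \<or> eventually (\<lambda>n. n \<notin> A) \<omega>"
    using assms(1) by (auto simp: nonprincipal_ultrafilter_def)
  have "eventually (\<lambda>x. x \<in> {-B..B}) (filtermap a \<omega>)"
    unfolding eventually_filtermap using bounded by eventually_elim auto
  moreover have "filtermap a \<omega> \<noteq> bot"
    using nontrivial by (simp add: filtermap_bot_iff)
  ultimately obtain l where l: "inf (nhds l) (filtermap a \<omega>) \<noteq> bot"
    using compact_Icc[of "-B" B] unfolding compact_filter by blast
  have "eventually (\<lambda>n. a n \<in> S) \<omega>" if "open S" "l \<in> S" for S
  proof (rule ccontr)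
    assume "\<not> eventually (\<lambda>n. a n \<in> S) \<omega>"
    then have "eventually (\<lambda>n. a n \<notin> S) \<omega>"
      using dichotomy[of "{n. a n \<in> S}"] by simp
    then have "eventually (\<lambda>x. x \<notin> S) (filtermap a \<omega>)"
      by (simp add: eventually_filtermap)
    moreover have "eventually (\<lambda>x. x \<in> S) (nhds l)"
      using that by (auto simp: eventually_nhds)
    ultimately have "eventually (\<lambda>x. False) (inf (nhds l) (filtermap a \<omega>))"
      unfolding eventually_inf by blast
    with l show False
      by (simp add: trivial_limit_def)
  qed
  then show ?thesis
    by (auto simp: tendsto_def)
qed

lemma nonprincipal_ultrafilter_le_sequentially:
  assumes "nonprincipal_ultrafilter \<omega>"
  shows "\<omega> \<le> sequentially"
proof (rule filter_leI)
  fix Q :: "nat \<Rightarrow> bool"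
  assume "eventually Q sequentially"
  then obtain k where k: "\<And>n. n \<ge> k \<Longrightarrow> Q n"
    by (auto simp: eventually_sequentially)
  have "eventually (\<lambda>n. n \<notin> {..<k}) \<omega>"
    using assms unfolding nonprincipal_ultrafilter_def by blast
  then show "eventually Q \<omega>"
    by eventually_elim (simp add: k)
qed

section \<open>The norm of a bi-invariant metric\<close>

context bi_invariant_metric_group
begin

abbreviation N :: "'a \<Rightarrow> real" where "N \<equiv> metric_norm G d"

lemma norm_nonneg: "0 \<le> N g"
  by (simp add: metric_norm_def)

lemma norm_one: "N \<one> = 0"
  by (simp add: metric_norm_def)

lemma norm_mult_le:
  assumes "g \<in> carrier G" "h \<in> carrier G"
  shows "N (g \<otimes> h) \<le> N g + N h"
proof -
  have "d (g \<otimes> h) \<one> \<le> d (g \<otimes> h) (\<one> \<otimes> h) + d h \<one>"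
    using triangle[of "g \<otimes> h" h \<one>] assms by simp
  also have "d (g \<otimes> h) (\<one> \<otimes> h) = d g \<one>"
    using assms by (intro right_invariant) auto
  finally show ?thesis
    by (simp add: metric_norm_def)
qed

lemma norm_inv:
  assumes "g \<in> carrier G"
  shows "N (inv g) = N g"
proof -
  have "d (inv g) \<one> = d (g \<otimes> inv g) (g \<otimes> \<one>)"
    using assms by (intro left_invariant[symmetric]) auto
  then show ?thesis
    using assms by (simp add: metric_norm_def commute)
qed

lemma norm_conjugate:
  assumes "g \<in> carrier G" "x \<in> carrier G"
  shows "N (x \<otimes> g \<otimes> inv x) = N g"
proof -
  have "d (x \<otimes> g \<otimes> inv x) \<one> = d (x \<otimes> g \<otimes> inv x) (x \<otimes> inv x)"
    using assms by simp
  also have "\<dots> = d (x \<otimes> g) (x \<otimes> \<one>)"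
    using assms right_invariant[of "inv x" "x \<otimes> g" x] by simp
  also have "\<dots> = d g \<one>"
    using assms by (intro left_invariant) auto
  finally show ?thesis
    by (simp add: metric_norm_def)
qed

lemma norm_pow_le:
  assumes "g \<in> carrier G"
  shows "N (g [^] (n::nat)) \<le> real n * N g"
proof (induction n)
  case 0
  then show ?case by (simp add: norm_one)
next
  case (Suc n)
  then show ?case
    using norm_mult_le[of "g [^] n" g] assms by (simp add: algebra_simps)
qed

text \<open>
  Removing either factor of a product changes the norm by at most the norm of that factor.
  Thanks to this lemma, the norm of the cone is one of the functions \<open>F\<^sub>\<omega>\<close>, and the general facts
  about them apply to it.
\<close>

lemma partial_quasimorphism_norm: "partial_quasimorphism G N N"
proof -
  have "\<bar>N g - N (g \<otimes> h) + N h\<bar> \<le> 2 * min (N g) (N h)"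
    if "g \<in> carrier G" "h \<in> carrier G" for g h
  proof -
    have "N g \<le> N (g \<otimes> h) + N h"
      using norm_mult_le[of "g \<otimes> h" "inv h"] that by (simp add: m_assoc norm_inv)
    moreover have "N h \<le> N g + N (g \<otimes> h)"
      using norm_mult_le[of "inv g" "g \<otimes> h"] that by (simp add: m_assoc[symmetric] norm_inv)
    ultimately show ?thesis
      using norm_mult_le[OF that] by linarith
  qed
  then show ?thesis
    unfolding partial_quasimorphism_def by (intro exI[of _ 2]) auto
qed

section \<open>The group of sequences of linear growth\<close>

abbreviation P :: "(nat \<Rightarrow> 'a) monoid" where "P \<equiv> prod0 G d"

lemma mult_prod0: "g \<otimes>\<^bsub>P\<^esub> h = (\<lambda>n. g n \<otimes> h n)"
  by (simp add: prod0_def)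

lemma one_prod0: "\<one>\<^bsub>P\<^esub> = (\<lambda>n. \<one>)"
  by (simp add: prod0_def)

lemma prod0_memD: "g \<in> carrier P \<Longrightarrow> g n \<in> carrier G"
  by (simp add: prod0_def)

lemma pow_prod0: "g [^]\<^bsub>P\<^esub> (k::nat) = (\<lambda>n. g n [^] k)"
  by (induction k) (simp_all add: mult_prod0 one_prod0)

lemma group_prod0: "group P"
proof (rule groupI)
  fix g h
  assume gh: "g \<in> carrier P" "h \<in> carrier P"
  have "(\<lambda>n. N (g n \<otimes> h n)) \<in> O(\<lambda>n. N (g n) + N (h n))"
    using gh by (intro bigoI[where c=1])
      (simp add: prod0_memD norm_nonneg norm_mult_le)
  also have "(\<lambda>n. N (g n) + N (h n)) \<in> O(\<lambda>n. real n)"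
    using gh by (intro sum_in_bigo) (auto simp: prod0_def)
  finally show "g \<otimes>\<^bsub>P\<^esub> h \<in> carrier P"
    using gh by (simp add: prod0_def)
next
  show "\<one>\<^bsub>P\<^esub> \<in> carrier P"
    by (simp add: prod0_def norm_one)
next
  fix g
  assume g: "g \<in> carrier P"
  then have "(\<lambda>n. N (inv (g n))) = (\<lambda>n. N (g n))"
    by (auto simp: prod0_memD norm_inv)
  then have "(\<lambda>n. inv (g n)) \<in> carrier P"
    using g by (simp add: prod0_def)
  moreover have "(\<lambda>n. inv (g n)) \<otimes>\<^bsub>P\<^esub> g = \<one>\<^bsub>P\<^esub>"
    using g by (auto simp: mult_prod0 one_prod0 prod0_memD)
  ultimately show "\<exists>y\<in>carrier P. y \<otimes>\<^bsub>P\<^esub> g = \<one>\<^bsub>P\<^esub>"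
    by blast
qed (auto simp: mult_prod0 one_prod0 prod0_memD m_assoc)

lemma inv_prod0:
  assumes "g \<in> carrier P"
  shows "inv\<^bsub>P\<^esub> g = (\<lambda>n. inv (g n))"
proof (rule ext)
  fix n
  interpret P: group P by (rule group_prod0)
  have "(inv\<^bsub>P\<^esub> g \<otimes>\<^bsub>P\<^esub> g) n = \<one>"
    using P.l_inv[OF assms] by (simp only: one_prod0)
  then show "(inv\<^bsub>P\<^esub> g) n = inv (g n)"
    using P.inv_closed[OF assms] assms
    by (intro inv_equality[symmetric]) (auto simp: mult_prod0 prod0_memD)
qed

lemma power_sequence_in_prod0:
  assumes "g \<in> carrier G"
  shows "(\<lambda>n. g [^] n) \<in> carrier P"
proof -
  have "(\<lambda>n. N (g [^] n)) \<in> O(\<lambda>n. real n)"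
    using norm_pow_le[OF assms]
    by (intro bigoI[where c="N g"]) (auto simp: norm_nonneg mult.commute)
  then show ?thesis
    using assms by (simp add: prod0_def)
qed

end

section \<open>Rates of growth along the ultrafilter\<close>

locale bi_invariant_metric_group_ultrafilter = bi_invariant_metric_group +
  fixes \<omega> :: "nat filter"
  assumes ultrafilter: "nonprincipal_ultrafilter \<omega>"
begin

abbreviation rate :: "('a \<Rightarrow> real) \<Rightarrow> (nat \<Rightarrow> 'a) \<Rightarrow> real" where "rate \<equiv> lim_rate \<omega>"

abbreviation NP :: "(nat \<Rightarrow> 'a) \<Rightarrow> real" where "NP \<equiv> prod0_norm G d \<omega>"

abbreviation null :: "(nat \<Rightarrow> 'a) set" where "null \<equiv> null_subgroup G d \<omega>"

definition linearly_bounded :: "('a \<Rightarrow> real) \<Rightarrow> bool" where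
  "linearly_bounded f \<longleftrightarrow> (\<exists>C>0. \<forall>g\<in>carrier G. \<bar>f g\<bar> \<le> C * N g)"

lemma ultrafilter_nontrivial: "\<omega> \<noteq> bot"
  using ultrafilter by (simp add: nonprincipal_ultrafilter_def)

lemma linearly_bounded_norm: "linearly_bounded N"
  unfolding linearly_bounded_def by (intro exI[of _ 1]) (auto simp: norm_nonneg)

lemma tendsto_rate:
  assumes "linearly_bounded f" "g \<in> carrier P"
  shows "((\<lambda>n. f (g n) / real n) \<longlongrightarrow> rate f g) \<omega>"
proof -
  obtain C where C: "C > 0" "\<And>x. x \<in> carrier G \<Longrightarrow> \<bar>f x\<bar> \<le> C * N x"
    using assms(1) by (auto simp: linearly_bounded_def)
  have "(\<lambda>n. N (g n)) \<in> O(\<lambda>n. real n)"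
    using assms(2) by (simp add: prod0_def)
  then obtain c where "eventually (\<lambda>n. norm (N (g n)) \<le> c * norm (real n)) sequentially"
    by (elim landau_o.bigE)
  then have "eventually (\<lambda>n. N (g n) \<le> c * real n \<and> n > 0) sequentially"
    using eventually_gt_at_top[of 0] by eventually_elim (simp add: norm_nonneg)
  then have "eventually (\<lambda>n. N (g n) \<le> c * real n \<and> n > 0) \<omega>"
    using nonprincipal_ultrafilter_le_sequentially[OF ultrafilter] by (simp add: filter_leD)
  then have "eventually (\<lambda>n. \<bar>f (g n) / real n\<bar> \<le> C * c) \<omega>"
  proof eventually_elim
    case (elim n)
    have "\<bar>f (g n)\<bar> \<le> C * N (g n)"
      using C(2) assms(2) by (simp add: prod0_memD)
    also have "\<dots> \<le> C * (c * real n)"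
      using C(1) elim by (intro mult_left_mono) auto
    finally show ?case
      using elim by (simp add: field_simps)
  qed
  then obtain l where "((\<lambda>n. f (g n) / real n) \<longlongrightarrow> l) \<omega>"
    using ultrafilter_bounded_tendsto[OF ultrafilter, where a = "\<lambda>n. f (g n) / real n"] by blast
  then show ?thesis
    using tendsto_Lim[OF ultrafilter_nontrivial] unfolding lim_rate_def by metis
qed

lemma tendsto_prod0_norm:
  "g \<in> carrier P \<Longrightarrow> ((\<lambda>n. N (g n) / real n) \<longlongrightarrow> NP g) \<omega>"
  using tendsto_rate[OF linearly_bounded_norm] by (simp add: prod0_norm_def)

lemma prod0_norm_nonneg: "g \<in> carrier P \<Longrightarrow> 0 \<le> NP g"
  by (rule tendsto_lowerbound[OF tendsto_prod0_norm _ ultrafilter_nontrivial])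
    (auto simp: norm_nonneg)

lemma prod0_norm_mult_le:
  assumes "g \<in> carrier P" "h \<in> carrier P"
  shows "NP (g \<otimes>\<^bsub>P\<^esub> h) \<le> NP g + NP h"
proof (rule tendsto_le[OF ultrafilter_nontrivial])
  interpret P: group P by (rule group_prod0)
  show "((\<lambda>n. N (g n) / real n + N (h n) / real n) \<longlongrightarrow> NP g + NP h) \<omega>"
    using assms by (intro tendsto_add tendsto_prod0_norm)
  show "((\<lambda>n. N ((g \<otimes>\<^bsub>P\<^esub> h) n) / real n) \<longlongrightarrow> NP (g \<otimes>\<^bsub>P\<^esub> h)) \<omega>"
    using assms by (intro tendsto_prod0_norm) auto
  show "\<forall>\<^sub>F n in \<omega>. N ((g \<otimes>\<^bsub>P\<^esub> h) n) / real n \<le> N (g n) / real n + N (h n) / real n"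
    using assms
    by (simp add: mult_prod0 add_divide_distrib[symmetric] divide_right_mono norm_mult_le prod0_memD)
qed

lemma prod0_norm_inv: "g \<in> carrier P \<Longrightarrow> NP (inv\<^bsub>P\<^esub> g) = NP g"
  by (simp add: prod0_norm_def lim_rate_def inv_prod0 norm_inv prod0_memD)

lemma prod0_norm_conjugate:
  assumes "g \<in> carrier P" "x \<in> carrier P"
  shows "NP (x \<otimes>\<^bsub>P\<^esub> g \<otimes>\<^bsub>P\<^esub> inv\<^bsub>P\<^esub> x) = NP g"
  using assms
  by (simp add: prod0_norm_def lim_rate_def inv_prod0 mult_prod0 norm_conjugate prod0_memD)

lemma null_subgroup_normal: "null \<lhd> P"
proof -
  interpret P: group P by (rule group_prod0)
  have "NP \<one>\<^bsub>P\<^esub> = 0"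
    using tendsto_Lim[OF ultrafilter_nontrivial tendsto_const]
    by (simp add: prod0_norm_def lim_rate_def one_prod0 norm_one)
  then have one: "\<one>\<^bsub>P\<^esub> \<in> null"
    by (simp add: null_subgroup_def)
  have "subgroup null P"
  proof (rule P.subgroupI)
    show "g \<otimes>\<^bsub>P\<^esub> h \<in> null" if "g \<in> null" "h \<in> null" for g h
      using that prod0_norm_mult_le[of g h] prod0_norm_nonneg[of "g \<otimes>\<^bsub>P\<^esub> h"]
      by (auto simp: null_subgroup_def)
  qed (use one in \<open>auto simp: null_subgroup_def prod0_norm_inv\<close>)
  then show ?thesis
    unfolding P.normal_inv_iff
    by (auto simp: null_subgroup_def prod0_norm_conjugate)
qed

lemma rate_eq_0_if_null:
  assumes "linearly_bounded f" "z \<in> null"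
  shows "rate f z = 0"
proof -
  obtain C where C: "C > 0" "\<And>x. x \<in> carrier G \<Longrightarrow> \<bar>f x\<bar> \<le> C * N x"
    using assms(1) by (auto simp: linearly_bounded_def)
  have z: "z \<in> carrier P" "NP z = 0"
    using assms(2) by (auto simp: null_subgroup_def)
  have "\<bar>rate f z\<bar> \<le> C * NP z"
  proof (rule tendsto_le[OF ultrafilter_nontrivial])
    show "((\<lambda>n. C * (N (z n) / real n)) \<longlongrightarrow> C * NP z) \<omega>"
      using z by (intro tendsto_mult tendsto_const tendsto_prod0_norm)
    show "((\<lambda>n. \<bar>f (z n) / real n\<bar>) \<longlongrightarrow> \<bar>rate f z\<bar>) \<omega>"
      using z assms(1) by (intro tendsto_rabs tendsto_rate)
    show "\<forall>\<^sub>F n in \<omega>. \<bar>f (z n) / real n\<bar> \<le> C * (N (z n) / real n)"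
      using C z by (simp add: prod0_memD divide_right_mono)
  qed
  then show ?thesis
    using z by simp
qed

lemma tendsto_defect:
  assumes "linearly_bounded f" "g \<in> carrier P" "h \<in> carrier P"
  shows "((\<lambda>n. \<bar>f (g n) - f (g n \<otimes> h n) + f (h n)\<bar> / real n)
            \<longlongrightarrow> \<bar>rate f g - rate f (g \<otimes>\<^bsub>P\<^esub> h) + rate f h\<bar>) \<omega>"
proof -
  interpret P: group P by (rule group_prod0)
  have "((\<lambda>n. \<bar>f (g n) / real n - f ((g \<otimes>\<^bsub>P\<^esub> h) n) / real n + f (h n) / real n\<bar>)
            \<longlongrightarrow> \<bar>rate f g - rate f (g \<otimes>\<^bsub>P\<^esub> h) + rate f h\<bar>) \<omega>"
    using assms by (intro tendsto_rabs tendsto_add tendsto_diff tendsto_rate) auto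
  then show ?thesis
    by (simp add: mult_prod0 add_divide_distrib[symmetric] diff_divide_distrib[symmetric])
qed

lemma partial_quasimorphism_rate:
  assumes "linearly_bounded f" "partial_quasimorphism G N f"
  shows "partial_quasimorphism P NP (rate f)"
proof -
  obtain D where D: "D \<ge> 0"
    "\<And>x y. x \<in> carrier G \<Longrightarrow> y \<in> carrier G \<Longrightarrow> \<bar>f x - f (x \<otimes> y) + f y\<bar> \<le> D * min (N x) (N y)"
    using assms(2) unfolding partial_quasimorphism_def by blast
  have "\<bar>rate f g - rate f (g \<otimes>\<^bsub>P\<^esub> h) + rate f h\<bar> \<le> D * min (NP g) (NP h)"
    if gh: "g \<in> carrier P" "h \<in> carrier P" for g h
  proof (rule tendsto_le[OF ultrafilter_nontrivial _ tendsto_defect[OF assms(1) gh]])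
    show "((\<lambda>n. D * min (N (g n) / real n) (N (h n) / real n)) \<longlongrightarrow> D * min (NP g) (NP h)) \<omega>"
      using gh by (intro tendsto_mult tendsto_const tendsto_min tendsto_prod0_norm)
    have "\<bar>f (g n) - f (g n \<otimes> h n) + f (h n)\<bar> / real n
            \<le> D * min (N (g n) / real n) (N (h n) / real n)" for n
    proof -
      have "\<bar>f (g n) - f (g n \<otimes> h n) + f (h n)\<bar> / real n \<le> D * min (N (g n)) (N (h n)) / real n"
        using D(2) gh by (intro divide_right_mono) (auto simp: prod0_memD)
      also have "\<dots> = D * min (N (g n) / real n) (N (h n) / real n)"
        using min_divide_distrib_right[of "N (g n)" "N (h n)" "real n"]
        by (simp flip: times_divide_eq_right)
      finally show ?thesis .
    qed
    then show "\<forall>\<^sub>F n in \<omega>. \<bar>f (g n) - f (g n \<otimes> h n) + f (h n)\<bar> / real n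
            \<le> D * min (N (g n) / real n) (N (h n) / real n)"
      by (rule always_eventually[OF allI])
  qed
  then show ?thesis
    using D(1) unfolding partial_quasimorphism_def by blast
qed

text \<open>
  Nothing is known about \<open>\<phi>\<close> on bounded sets. There the linear bound on \<open>f\<close> takes over: it keeps
  the defect below a constant, and the constant disappears after division by \<open>n\<close>. What remains
  is \<open>\<epsilon>\<close> times the norms of the two sequences, for every \<open>\<epsilon> > 0\<close>.
\<close>

lemma rate_mult_if_sublinear_defect:
  assumes lin: "linearly_bounded f"
    and defect: "\<And>x y. x \<in> carrier G \<Longrightarrow> y \<in> carrier G \<Longrightarrow>
      \<bar>f x - f (x \<otimes> y) + f y\<bar> \<le> \<phi> (N x + N y)"
    and sublinear: "((\<lambda>x. \<phi> x / x) \<longlongrightarrow> 0) at_top"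
    and gh: "g \<in> carrier P" "h \<in> carrier P"
  shows "rate f (g \<otimes>\<^bsub>P\<^esub> h) = rate f g + rate f h"
proof -
  obtain C where C: "C > 0" "\<And>x. x \<in> carrier G \<Longrightarrow> \<bar>f x\<bar> \<le> C * N x"
    using lin by (auto simp: linearly_bounded_def)
  have bound: "\<bar>rate f g - rate f (g \<otimes>\<^bsub>P\<^esub> h) + rate f h\<bar> \<le> \<epsilon> * (NP g + NP h)"
    if "\<epsilon> > 0" for \<epsilon>
  proof -
    have "eventually (\<lambda>x. \<phi> x / x < \<epsilon> \<and> x > 0) at_top"
      using order_tendstoD(2)[OF sublinear that] eventually_gt_at_top[of 0]
      by (rule eventually_conj)
    then obtain R where R: "\<And>x. x \<ge> R \<Longrightarrow> \<phi> x / x < \<epsilon> \<and> x > 0"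
      by (auto simp: eventually_at_top_linorder)
    have R_pos: "R > 0"
      using R[of R] by simp
    have R_le: "\<phi> x \<le> \<epsilon> * x" if "x \<ge> R" for x
    proof -
      have "\<phi> x / x < \<epsilon>" "x > 0"
        using R[OF that] by auto
      then show ?thesis
        by (simp add: pos_divide_less_eq)
    qed
    have defect': "\<bar>f x - f (x \<otimes> y) + f y\<bar> \<le> \<epsilon> * (N x + N y) + 2 * C * R"
      if xy: "x \<in> carrier G" "y \<in> carrier G" for x y
    proof (cases "N x + N y \<ge> R")
      case True
      have "0 \<le> 2 * C * R"
        using C R_pos by simp
      then show ?thesis
        using defect[OF xy] R_le[OF True] by linarith
    next
      case False
      have "\<bar>f x - f (x \<otimes> y) + f y\<bar> \<le> C * N x + C * N (x \<otimes> y) + C * N y"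
        using C(2)[of x] C(2)[of y] C(2)[of "x \<otimes> y"] xy m_closed[OF xy] by linarith
      also have "\<dots> = C * (N x + N (x \<otimes> y) + N y)"
        by (simp add: algebra_simps)
      also have "\<dots> \<le> C * (2 * R)"
        using norm_mult_le[OF xy] False C(1) by (intro mult_left_mono) auto
      also have "\<dots> \<le> \<epsilon> * (N x + N y) + 2 * C * R"
        using \<open>\<epsilon> > 0\<close> by (simp add: norm_nonneg)
      finally show ?thesis .
    qed
    have "((\<lambda>n. 2 * C * R / real n) \<longlongrightarrow> 0) \<omega>"
      using nonprincipal_ultrafilter_le_sequentially[OF ultrafilter]
      by (rule filterlim_mono[OF lim_const_over_n order_refl])
    then have limit: "((\<lambda>n. \<epsilon> * (N (g n) / real n + N (h n) / real n) + 2 * C * R / real n)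
        \<longlongrightarrow> \<epsilon> * (NP g + NP h) + 0) \<omega>"
      using gh by (intro tendsto_add tendsto_mult tendsto_const tendsto_prod0_norm)
    have "\<bar>f (g n) - f (g n \<otimes> h n) + f (h n)\<bar> / real n
        \<le> \<epsilon> * (N (g n) / real n + N (h n) / real n) + 2 * C * R / real n" for n
    proof -
      have "\<bar>f (g n) - f (g n \<otimes> h n) + f (h n)\<bar> / real n
          \<le> (\<epsilon> * (N (g n) + N (h n)) + 2 * C * R) / real n"
        using defect' gh by (intro divide_right_mono) (auto simp: prod0_memD)
      then show ?thesis
        by (simp add: add_divide_distrib distrib_left)
    qed
    then have "\<bar>rate f g - rate f (g \<otimes>\<^bsub>P\<^esub> h) + rate f h\<bar> \<le> \<epsilon> * (NP g + NP h) + 0"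
      by (intro tendsto_le[OF ultrafilter_nontrivial limit tendsto_defect[OF lin gh]]
          always_eventually allI)
    then show ?thesis
      by simp
  qed
  have "\<bar>rate f g - rate f (g \<otimes>\<^bsub>P\<^esub> h) + rate f h\<bar> \<le> 0"
  proof (rule field_le_epsilon)
    fix e :: real
    assume "e > 0"
    let ?s = "NP g + NP h"
    have s: "0 \<le> ?s"
      using gh by (simp add: prod0_norm_nonneg)
    have "e / (?s + 1) * ?s \<le> e"
      using s \<open>e > 0\<close> by (simp add: field_simps)
    moreover have "e / (?s + 1) > 0"
      using s \<open>e > 0\<close> by simp
    ultimately show "\<bar>rate f g - rate f (g \<otimes>\<^bsub>P\<^esub> h) + rate f h\<bar> \<le> 0 + e"
      using bound[of "e / (?s + 1)"] by linarith
  qed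
  then show ?thesis
    by linarith
qed

lemma rate_pow:
  assumes "linearly_bounded f" "homogeneous G f" "g \<in> carrier P"
  shows "rate f (g [^]\<^bsub>P\<^esub> (k::nat)) = real k * rate f g"
proof -
  have "((\<lambda>n. real k * (f (g n) / real n)) \<longlongrightarrow> real k * rate f g) \<omega>"
    using assms by (intro tendsto_mult tendsto_const tendsto_rate)
  moreover have "f (g n [^] k) = real k * f (g n)" for n
    using assms(2,3) by (simp add: homogeneous_def prod0_memD)
  ultimately show ?thesis
    using tendsto_Lim[OF ultrafilter_nontrivial] by (simp add: lim_rate_def pow_prod0)
qed

section \<open>Passing to the asymptotic cone\<close>

abbreviation K :: "(nat \<Rightarrow> 'a) set monoid" where "K \<equiv> Cone G d \<omega>"

abbreviation cls :: "(nat \<Rightarrow> 'a) \<Rightarrow> (nat \<Rightarrow> 'a) set" where "cls \<equiv> cone_class G d \<omega>"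

lemma carrier_cone: "carrier K = cls ` carrier P"
  by (auto simp: Cone_def FactGroup_def RCOSETS_def cone_class_def)

lemma mult_cone:
  "\<lbrakk>g \<in> carrier P; h \<in> carrier P\<rbrakk> \<Longrightarrow> cls g \<otimes>\<^bsub>K\<^esub> cls h = cls (g \<otimes>\<^bsub>P\<^esub> h)"
  using normal.rcos_sum[OF null_subgroup_normal] by (simp add: Cone_def FactGroup_def cone_class_def)

lemma pow_cone:
  assumes "g \<in> carrier P"
  shows "cls g [^]\<^bsub>K\<^esub> (k::nat) = cls (g [^]\<^bsub>P\<^esub> k)"
proof (induction k)
  case 0
  interpret P: group P by (rule group_prod0)
  have "null \<subseteq> carrier P"
    by (auto simp: null_subgroup_def)
  then show ?case
    by (simp add: Cone_def FactGroup_def cone_class_def P.coset_mult_one)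
next
  case (Suc k)
  interpret P: group P by (rule group_prod0)
  show ?case
    using Suc assms by (simp add: mult_cone)
qed

text \<open>
  Two sequences in the same class differ by a null sequence on the left, so it suffices that such
  a factor does not affect the rate.
\<close>

lemma cone_ext_well_definedI:
  assumes "\<And>z g. z \<in> null \<Longrightarrow> g \<in> carrier P \<Longrightarrow> rate f (z \<otimes>\<^bsub>P\<^esub> g) = rate f g"
  shows "cone_ext_well_defined G d \<omega> f"
  unfolding cone_ext_well_defined_def
proof (intro ballI impI)
  fix g h
  assume gh: "g \<in> carrier P" "h \<in> carrier P" "cls g = cls h"
  interpret P: group P by (rule group_prod0)
  have "h \<in> cls h"
    using P.rcos_self[OF gh(2)] null_subgroup_normal
    by (simp add: cone_class_def normal_imp_subgroup)
  then obtain z where "z \<in> null" "h = z \<otimes>\<^bsub>P\<^esub> g"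
    using gh(3) by (auto simp: cone_class_def r_coset_def)
  then show "rate f g = rate f h"
    using assms gh(1) by simp
qed

lemma cone_ext_class:
  assumes "cone_ext_well_defined G d \<omega> f" "g \<in> carrier P"
  shows "cone_ext \<omega> f (cls g) = rate f g"
proof -
  interpret P: group P by (rule group_prod0)
  have sub: "subgroup null P"
    using null_subgroup_normal by (rule normal_imp_subgroup)
  have self: "g \<in> cls g"
    using P.rcos_self[OF assms(2) sub] by (simp add: cone_class_def)
  have "rate f h = rate f g" if "h \<in> cls g" for h
  proof -
    have "h \<in> carrier P"
      using that P.r_coset_subset_G[OF subgroup.subset[OF sub] assms(2)]
      by (auto simp: cone_class_def)
    moreover have "cls g = cls h"
      using P.repr_independence[OF _ assms(2) sub, of h] that by (simp add: cone_class_def)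
    ultimately show ?thesis
      using assms unfolding cone_ext_well_defined_def by metis
  qed
  then have "rate f ` cls g = {rate f g}"
    using self by blast
  then show ?thesis
    by (simp add: cone_ext_def)
qed

text \<open>
  Multiplying by a null sequence creates no defect in the rate, because the defect is controlled
  by the smaller of the two norms.
\<close>

lemma cone_ext_well_defined_partial_quasimorphism:
  assumes "linearly_bounded f" "partial_quasimorphism G N f"
  shows "cone_ext_well_defined G d \<omega> f"
proof (rule cone_ext_well_definedI)
  fix z g
  assume zg: "z \<in> null" "g \<in> carrier P"
  obtain D where
    "\<bar>rate f z - rate f (z \<otimes>\<^bsub>P\<^esub> g) + rate f g\<bar> \<le> D * min (NP z) (NP g)"
    using partial_quasimorphism_rate[OF assms] zg
    unfolding partial_quasimorphism_def null_subgroup_def by blast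
  moreover have "min (NP z) (NP g) = 0"
    using zg prod0_norm_nonneg by (simp add: null_subgroup_def)
  ultimately show "rate f (z \<otimes>\<^bsub>P\<^esub> g) = rate f g"
    using rate_eq_0_if_null[OF assms(1) zg(1)] by simp
qed

lemma cone_norm_class: "g \<in> carrier P \<Longrightarrow> cone_norm G d \<omega> (cls g) = NP g"
  using cone_ext_class[OF cone_ext_well_defined_partial_quasimorphism
      [OF linearly_bounded_norm partial_quasimorphism_norm]]
  by (simp add: cone_norm_def cone_ext_def prod0_norm_def)

lemma partial_quasimorphism_cone_ext:
  assumes "linearly_bounded f" "partial_quasimorphism G N f"
  shows "partial_quasimorphism K (cone_norm G d \<omega>) (cone_ext \<omega> f)"
proof -
  interpret P: group P by (rule group_prod0)
  note ext = cone_ext_class[OF cone_ext_well_defined_partial_quasimorphism[OF assms]]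
  show ?thesis
    using partial_quasimorphism_rate[OF assms]
    by (simp add: partial_quasimorphism_def carrier_cone mult_cone ext cone_norm_class)
qed

lemma homogeneous_cone_ext:
  assumes "linearly_bounded f" "cone_ext_well_defined G d \<omega> f" "homogeneous G f"
  shows "homogeneous K (cone_ext \<omega> f)"
proof -
  interpret P: group P by (rule group_prod0)
  show ?thesis
    using assms
    by (simp add: homogeneous_def[of K] carrier_cone pow_cone cone_ext_class rate_pow)
qed

lemma cone_ext_hom_if_sublinear_defect:
  assumes lin: "linearly_bounded f"
    and defect: "\<And>x y. x \<in> carrier G \<Longrightarrow> y \<in> carrier G \<Longrightarrow>
      \<bar>f x - f (x \<otimes> y) + f y\<bar> \<le> \<phi> (N x + N y)"
    and sublinear: "((\<lambda>x. \<phi> x / x) \<longlongrightarrow> 0) at_top"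
  shows "cone_ext_well_defined G d \<omega> f" "cone_ext \<omega> f \<in> hom K real_group"
proof -
  interpret P: group P by (rule group_prod0)
  note mult = rate_mult_if_sublinear_defect[OF lin defect sublinear]
  show well_defined: "cone_ext_well_defined G d \<omega> f"
    by (rule cone_ext_well_definedI)
      (simp add: mult rate_eq_0_if_null[OF lin] null_subgroup_def)
  show "cone_ext \<omega> f \<in> hom K real_group"
    by (auto simp: hom_def real_group_def carrier_cone mult_cone cone_ext_class[OF well_defined] mult)
qed

lemma cone_power_closed: "g \<in> carrier G \<Longrightarrow> cone_power G d \<omega> g \<in> carrier K"
  by (simp add: cone_power_def carrier_cone power_sequence_in_prod0)

lemma cone_ext_cone_power:
  assumes "cone_ext_well_defined G d \<omega> f" "g \<in> carrier G"
  shows "cone_ext \<omega> f (cone_power G d \<omega> g) = power_limit G \<omega> f g"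
  using cone_ext_class[OF assms(1) power_sequence_in_prod0[OF assms(2)]]
  by (simp add: cone_power_def power_limit_def lim_rate_def)

end

theorem proposition1p13:
  fixes G :: "('a, 'b) monoid_scheme"
    and d :: "'a \<Rightarrow> 'a \<Rightarrow> real"
    and \<omega> :: "nat filter"
    and f :: "'a \<Rightarrow> real"
  assumes "bi_invariant_metric_group G d"
    and "nonprincipal_ultrafilter \<omega>"
    and "\<exists>C>0. \<forall>g\<in>carrier G. \<bar>f g\<bar> \<le> C * metric_norm G d g"
  shows
    "(\<forall>g\<in>carrier (prod0 G d). \<exists>l. ((\<lambda>n. f (g n) / real n) \<longlongrightarrow> l) \<omega>) \<and>
     (partial_quasimorphism G (metric_norm G d) f \<longrightarrow>
        cone_ext_well_defined G d \<omega> f \<and>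
        partial_quasimorphism (Cone G d \<omega>) (cone_norm G d \<omega>) (cone_ext \<omega> f)) \<and>
     (partial_quasimorphism G (metric_norm G d) f \<and> homogeneous G f \<longrightarrow>
        partial_quasimorphism (Cone G d \<omega>) (cone_norm G d \<omega>) (cone_ext \<omega> f) \<and>
        homogeneous (Cone G d \<omega>) (cone_ext \<omega> f)) \<and>
     (\<forall>\<phi> :: real \<Rightarrow> real.
        (\<forall>g\<in>carrier G. \<forall>h\<in>carrier G.
           \<bar>f g - f (g \<otimes>\<^bsub>G\<^esub> h) + f h\<bar> \<le> \<phi> (metric_norm G d g + metric_norm G d h)) \<and>
        ((\<lambda>x. \<phi> x / x) \<longlongrightarrow> 0) at_top \<longrightarrow>
        cone_ext_well_defined G d \<omega> f \<and>
        cone_ext \<omega> f \<in> hom (Cone G d \<omega>) real_group) \<and>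
     cone_power G d \<omega> \<in> carrier G \<rightarrow> carrier (Cone G d \<omega>) \<and>
     (cone_ext_well_defined G d \<omega> f \<longrightarrow>
        (\<forall>g\<in>carrier G. (cone_ext \<omega> f \<circ> cone_power G d \<omega>) g = power_limit G \<omega> f g))"
proof -
  interpret bi_invariant_metric_group_ultrafilter G d \<omega>
    using assms(1,2)
    by (simp add: bi_invariant_metric_group_ultrafilter_def
        bi_invariant_metric_group_ultrafilter_axioms_def)
  have lin: "linearly_bounded f"
    using assms(3) by (simp add: linearly_bounded_def)
  note well_defined = cone_ext_well_defined_partial_quasimorphism[OF lin]
  show ?thesis
  proof (intro conjI allI impI; (elim conjE)?)
    show "\<forall>g\<in>carrier (prod0 G d). \<exists>l. ((\<lambda>n. f (g n) / real n) \<longlongrightarrow> l) \<omega>"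
      using tendsto_rate[OF lin] by blast
  next
    assume pq: "partial_quasimorphism G N f"
    show "cone_ext_well_defined G d \<omega> f"
      by (rule well_defined[OF pq])
    show "partial_quasimorphism (Cone G d \<omega>) (cone_norm G d \<omega>) (cone_ext \<omega> f)"
      by (rule partial_quasimorphism_cone_ext[OF lin pq])
    then show "partial_quasimorphism (Cone G d \<omega>) (cone_norm G d \<omega>) (cone_ext \<omega> f)" .
  next
    assume "partial_quasimorphism G N f" "homogeneous G f"
    then show "homogeneous (Cone G d \<omega>) (cone_ext \<omega> f)"
      by (intro homogeneous_cone_ext[OF lin] well_defined)
  next
    fix \<phi> :: "real \<Rightarrow> real"
    assume defect:
        "\<forall>g\<in>carrier G. \<forall>h\<in>carrier G. \<bar>f g - f (g \<otimes>\<^bsub>G\<^esub> h) + f h\<bar> \<le> \<phi> (N g + N h)"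
      and sublinear: "((\<lambda>x. \<phi> x / x) \<longlongrightarrow> 0) at_top"
    show "cone_ext_well_defined G d \<omega> f"
      using cone_ext_hom_if_sublinear_defect(1)[OF lin _ sublinear] defect by blast
    show "cone_ext \<omega> f \<in> hom (Cone G d \<omega>) real_group"
      using cone_ext_hom_if_sublinear_defect(2)[OF lin _ sublinear] defect by blast
  next
    show "cone_power G d \<omega> \<in> carrier G \<rightarrow> carrier (Cone G d \<omega>)"
      using cone_power_closed by blast
  next
    assume "cone_ext_well_defined G d \<omega> f"
    then show "\<forall>g\<in>carrier G. (cone_ext \<omega> f \<circ> cone_power G d \<omega>) g = power_limit G \<omega> f g"
      by (simp add: cone_ext_cone_power)
  qed
qed

end
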